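(* Define $\rho:[0,\infty)\to\mathbb{R}$ by \[ \rho(x)=\begin{cases}1 & (0\le x\le\tfrac12),\\[2pt] \dfrac{2}{\pi}\left(\arctan\!\left(\dfrac{1}{\sqrt{2x-1}}\right)-\dfrac{\sqrt{2x-1}}{2x}\right) & (x>\tfrac12).\end{cases} \] Then $\rho$ is continuous, satisfies for every $x>\tfrac12$ the equation \[ \frac{1}{x}=\mathrm{p.v.}\!\int_{0}^{\infty}\frac{\rho(y)}{x-y}\,dy , \] satisfies $\int_0^\infty\rho(x)\,dx=1$, and $0\le\rho(x)\le 1$ for all $x\ge 0$.
   Context: $\mathrm{p.v.}\int$ denotes the Cauchy principal value integral. *)

theory Defs
  imports "HOL-Analysis.Analysis"
begin

(* Only the values on {0..} are meaningful; the value 1 for x < 0 is a dummy. *)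
definition rho :: "real \<Rightarrow> real" where
  "rho x =
    (if x \<le> 1/2 then 1
     else 2 / pi * (arctan (1 / sqrt (2*x - 1)) - sqrt (2*x - 1) / (2*x)))"

(* Cauchy principal value at a single singular point c: the integrals over A with the
   symmetric neighbourhood of radius e around c removed exist as Lebesgue integrals, and
   tend to I as e decreases to 0. Requiring integrability excludes the convention that
   the integral of a non-integrable function is 0. *)
definition has_pv_integral ::
    "(real \<Rightarrow> real) \<Rightarrow> real \<Rightarrow> real set \<Rightarrow> real \<Rightarrow> bool" where
  "has_pv_integral f I A c \<longleftrightarrow>
    (\<forall>e>0. set_integrable lborel (A - {c - e<..<c + e}) f) \<and>
    ((\<lambda>e. LBINT y:(A - {c - e<..<c + e}). f y) \<longlongrightarrow> I) (at_right 0)"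

end

(* For y > 1/2 put s = sqrt (2y - 1). Then arctan (1/s) is the integral of s / (s^2 + u^2) over u in
   [0, 1], and rho y is 2/pi times the difference of this integral and its integrand at u = 1.
   With a = sqrt (2x - 1), so that 2(x - y) = a^2 - s^2, the quotient of s / (s^2 + u^2) by x - y has
   an elementary antiderivative in y, and its principal value over y > 1/2 is - pi u / (a^2 + u^2):
   the logarithms produced on the two sides of the singularity cancel in the limit. The error for a
   finite excision radius is bounded uniformly in u, so Fubini's theorem lets one integrate over u.
   The integral over u yields - ln (x / (x - 1/2)), which cancels the contribution of
   [0, 1/2], where rho = 1, and the term at u = 1 leaves 1/x. *)

theory Submission
  imports Defs
begin

section \<open>Integrals by antiderivatives on open intervals\<close>

text \<open>For a nonnegative integrand, one-sided limits of the antiderivative already give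
  integrability. This allows singular ends: the integrands below involve
  \<open>sqrt (2*y - 1)\<close> and can be unbounded at \<open>1/2\<close>.\<close>

lemma has_bochner_integral_FTC_Ioo_nonneg:
  fixes f F :: "real \<Rightarrow> real"
  assumes ab: "a < b"
    and F: "\<And>x. a < x \<Longrightarrow> x < b \<Longrightarrow> (F has_real_derivative f x) (at x)"
    and f: "\<And>x. a < x \<Longrightarrow> x < b \<Longrightarrow> isCont f x"
    and nonneg: "\<And>x. a < x \<Longrightarrow> x < b \<Longrightarrow> 0 \<le> f x"
    and A: "(F \<longlongrightarrow> A) (at_right a)" and B: "(F \<longlongrightarrow> B) (at_left b)"
  shows "has_bochner_integral lborel (\<lambda>x. indicator {a<..<b} x * f x) (B - A)"
proof -
  have "set_integrable lborel (einterval (ereal a) (ereal b)) f"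
    and "(LBINT x=ereal a..ereal b. f x) = B - A"
    by (rule interval_integral_FTC_nonneg[where F = F];
        use assms in \<open>auto simp: ereal_tendsto_simps\<close>)+
  then show ?thesis
    using ab by (simp add: has_bochner_integral_iff set_integrable_def
        interval_lebesgue_integral_def set_lebesgue_integral_def)
qed

lemma has_bochner_integral_FTC_Ioi_nonneg:
  fixes f F :: "real \<Rightarrow> real"
  assumes F: "\<And>x. a < x \<Longrightarrow> (F has_real_derivative f x) (at x)"
    and f: "\<And>x. a < x \<Longrightarrow> isCont f x"
    and nonneg: "\<And>x. a < x \<Longrightarrow> 0 \<le> f x"
    and A: "(F \<longlongrightarrow> A) (at_right a)" and B: "(F \<longlongrightarrow> B) at_top"
  shows "has_bochner_integral lborel (\<lambda>x. indicator {a<..} x * f x) (B - A)"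
proof -
  have "set_integrable lborel (einterval (ereal a) \<infinity>) f"
    and "(LBINT x=ereal a..\<infinity>. f x) = B - A"
    by (rule interval_integral_FTC_nonneg[where F = F];
        use assms in \<open>auto simp: ereal_tendsto_simps\<close>)+
  then show ?thesis
    by (simp add: has_bochner_integral_iff set_integrable_def
        interval_lebesgue_integral_def set_lebesgue_integral_def)
qed

section \<open>The kernel and its integrals over \<open>u\<close>\<close>

text \<open>For \<open>y > 1/2\<close> and \<open>s = sqrt (2*y - 1)\<close> the denominator is
  \<open>s\<^sup>2 + u\<^sup>2\<close>. Thus \<open>kernel 0 y\<close> is \<open>1 / s\<close>, and
  \<open>kernel 1 y\<close> is the algebraic term \<open>s / (2*y)\<close> of
  \<open>rho\<close>.\<close>

definition kernel :: "real \<Rightarrow> real \<Rightarrow> real" where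
  "kernel u y = sqrt (2*y - 1) / (2*y - 1 + u\<^sup>2)"

lemma kernel_nonneg: "1/2 \<le> y \<Longrightarrow> 0 \<le> kernel u y"
  by (simp add: kernel_def)

text \<open>Supplies the majorant independent of \<open>u\<close> for Fubini's theorem.\<close>

lemma kernel_le_kernel_0: "1/2 < y \<Longrightarrow> kernel u y \<le> kernel 0 y"
  by (simp add: kernel_def frac_le)

lemma isCont_kernel: "1/2 < y \<Longrightarrow> isCont (kernel u) y"
  unfolding kernel_def[abs_def]
  by (intro continuous_intros) (simp add: add_pos_nonneg less_imp_neq[symmetric])

lemma kernel_measurable [measurable]: "case_prod kernel \<in> borel_measurable (borel \<Otimes>\<^sub>M borel)"
  unfolding kernel_def[abs_def] by measurable

lemma kernel_measurable' [measurable]: "kernel u \<in> borel_measurable borel"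
  unfolding kernel_def[abs_def] by measurable

lemma arctan_eq_integral_kernel:
  assumes "1/2 < y"
  shows "has_bochner_integral lborel (\<lambda>u. indicator {0..1} u * kernel u y)
           (arctan (1 / sqrt (2*y - 1)))"
proof -
  define s where "s = sqrt (2*y - 1)"
  have s: "s > 0" "2*y - 1 = s\<^sup>2" using assms by (auto simp: s_def)
  have "has_bochner_integral lborel (\<lambda>u. kernel u y * indicator {0..1} u)
           (arctan (1 / s) - arctan (0 / s))"
  proof (rule has_bochner_integral_FTC_Icc_real)
    fix u :: real
    have "s\<^sup>2 + u\<^sup>2 > 0" using s by (simp add: add_pos_nonneg)
    show "((\<lambda>u. arctan (u / s)) has_real_derivative kernel u y) (at u)"
      unfolding kernel_def s(2)
      using s \<open>s\<^sup>2 + u\<^sup>2 > 0\<close> by (auto intro!: derivative_eq_intros simp: field_simps power2_eq_square)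
    show "isCont (\<lambda>u. kernel u y) u"
      unfolding kernel_def s(2) using \<open>s\<^sup>2 + u\<^sup>2 > 0\<close> by (intro continuous_intros) auto
  qed simp
  then show ?thesis by (simp add: s_def mult.commute)
qed

text \<open>An antiderivative is \<open>ln (b + u\<^sup>2) / 2\<close>. With
  \<open>b = 2*x - 1\<close> this integrates over \<open>u\<close> the principal value belonging to
  \<open>kernel u\<close>, up to the factor \<open>- pi\<close>.\<close>

lemma integral_ratio_eq_ln:
  fixes b :: real
  assumes "b > 0"
  shows "has_bochner_integral lborel (\<lambda>u. indicator {0..1} u * (u / (b + u\<^sup>2)))
           ((ln (b + 1) - ln b) / 2)"
proof -
  have "has_bochner_integral lborel (\<lambda>u. (u / (b + u\<^sup>2)) * indicator {0..1} u)
           (ln (b + 1\<^sup>2) / 2 - ln (b + 0\<^sup>2) / 2)"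
  proof (rule has_bochner_integral_FTC_Icc_real)
    fix u :: real
    have "b + u\<^sup>2 > 0" using assms by (simp add: add_pos_nonneg)
    then show "((\<lambda>u. ln (b + u\<^sup>2) / 2) has_real_derivative u / (b + u\<^sup>2)) (at u)"
      by (auto intro!: derivative_eq_intros simp: field_simps power2_eq_square)
    show "isCont (\<lambda>u. u / (b + u\<^sup>2)) u"
      using \<open>b + u\<^sup>2 > 0\<close> by (intro continuous_intros) auto
  qed simp
  then show ?thesis by (simp add: mult.commute diff_divide_distrib)
qed

section \<open>Derivatives and limits of the square root and the logarithms\<close>

lemma has_derivative_sqrt_affine:
  "1/2 < y \<Longrightarrow> ((\<lambda>y. sqrt (2*y - 1)) has_real_derivative 1 / sqrt (2*y - 1)) (at y)"
  by (auto intro!: derivative_eq_intros simp: field_simps)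

lemma filterlim_sqrt_affine_at_top: "filterlim (\<lambda>y::real. sqrt (2*y - 1)) at_top at_top"
proof (rule filterlim_compose[OF sqrt_at_top])
  show "filterlim (\<lambda>y::real. 2*y - 1) at_top at_top"
    unfolding filterlim_at_top
  proof
    fix Z :: real
    show "eventually (\<lambda>y. Z \<le> 2*y - 1) at_top"
      using eventually_ge_at_top[of "(Z + 1) / 2"] by eventually_elim simp
  qed
qed

text \<open>The difference is the logarithm of
  \<open>(t + a) / (t - a) = 1 + 2 * a / (t - a)\<close>, which tends to 1.\<close>

lemma tendsto_ln_add_diff_ln_diff_at_top:
  fixes a :: real
  assumes "0 < a"
  shows "((\<lambda>t. ln (t + a) - ln (t - a)) \<longlongrightarrow> 0) at_top"
proof -
  have "filterlim (\<lambda>t. t - a) at_top at_top"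
    using filterlim_tendsto_add_at_top[OF tendsto_const[of "- a"] filterlim_ident] by simp
  then have "((\<lambda>t. 1 + 2 * a / (t - a)) \<longlongrightarrow> 1 + 0) at_top"
    by (intro tendsto_add tendsto_const tendsto_divide_0[OF tendsto_const] filterlim_at_top_imp_at_infinity)
  then have "((\<lambda>t. ln (1 + 2 * a / (t - a))) \<longlongrightarrow> ln (1 + 0)) at_top"
    by (rule tendsto_ln) simp
  moreover have "eventually (\<lambda>t. ln (1 + 2 * a / (t - a)) = ln (t + a) - ln (t - a)) at_top"
    using eventually_gt_at_top[of a]
  proof eventually_elim
    case (elim t)
    then have "1 + 2 * a / (t - a) = (t + a) / (t - a)" by (simp add: field_simps)
    with elim assms show ?case by (simp add: ln_div)
  qed
  ultimately show ?thesis using tendsto_cong by force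
qed

section \<open>Integrals of the kernel divided by \<open>x - y\<close> on either side of
  \<open>x\<close>\<close>

lemma has_real_derivative_ln_compose:
  fixes g :: "real \<Rightarrow> real"
  shows "(g has_real_derivative m) (at y) \<Longrightarrow> 0 < g y
    \<Longrightarrow> ((\<lambda>y. ln (g y)) has_real_derivative m / g y) (at y)"
  by (auto intro!: derivative_eq_intros)

text \<open>\<open>D\<close> stands for the logarithmic part, which takes different forms left and right of \<open>x\<close>.
  The case \<open>u = 0\<close> is covered because of \<open>t / 0 = 0\<close>.\<close>

lemma kernel_quotient_antiderivative:
  assumes x: "1/2 < x" and y: "1/2 < y" "y \<noteq> x"
    and D: "(D has_real_derivative sqrt (2*x - 1) / (x - y) / sqrt (2*y - 1)) (at y)"
  shows "((\<lambda>y. 2 / (2*x - 1 + u\<^sup>2) * (sqrt (2*x - 1) / 2 * D y - u * arctan (sqrt (2*y - 1) / u)))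
           has_real_derivative kernel u y / (x - y)) (at y)"
proof -
  define s where "s = sqrt (2*y - 1)"
  have s: "s > 0" "2*y - 1 = s\<^sup>2" using y by (auto simp: s_def)
  have pos: "s\<^sup>2 + u\<^sup>2 > 0" "2*x - 1 + u\<^sup>2 > 0" using s x by (simp_all add: add_pos_nonneg)
  have "((\<lambda>y. u * arctan (sqrt (2*y - 1) / u)) has_real_derivative u\<^sup>2 / (s\<^sup>2 + u\<^sup>2) / s) (at y)"
  proof (cases "u = 0")
    case False
    have "((\<lambda>y. u * arctan (sqrt (2*y - 1) / u)) has_real_derivative
        u * (inverse (1 + (sqrt (2*y - 1) / u)\<^sup>2) * (1 / sqrt (2*y - 1) / u))) (at y)"
      by (intro DERIV_cmult DERIV_chain2[OF DERIV_arctan] DERIV_cdivide has_derivative_sqrt_affine y)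
    also have "u * (inverse (1 + (sqrt (2*y - 1) / u)\<^sup>2) * (1 / sqrt (2*y - 1) / u))
        = u\<^sup>2 / (s\<^sup>2 + u\<^sup>2) / s"
      using False s pos unfolding s_def[symmetric]
      by (simp add: divide_simps power_divide)
    finally show ?thesis .
  qed simp
  from DERIV_cmult[OF DERIV_diff[OF DERIV_cmult[OF D, of "sqrt (2*x - 1) / 2"] this], of "2 / (2*x - 1 + u\<^sup>2)"]
  have "((\<lambda>y. 2 / (2*x - 1 + u\<^sup>2) * (sqrt (2*x - 1) / 2 * D y - u * arctan (sqrt (2*y - 1) / u)))
      has_real_derivative 2 / (2*x - 1 + u\<^sup>2) *
        (sqrt (2*x - 1) / 2 * (sqrt (2*x - 1) / (x - y) / s) - u\<^sup>2 / (s\<^sup>2 + u\<^sup>2) / s)) (at y)"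
    by (simp add: s_def)
  also have "sqrt (2*x - 1) / 2 * (sqrt (2*x - 1) / (x - y) / s) = (2*x - 1) / (2 * (x - y) * s)"
    using x by simp
  \<comment> \<open>Partial fractions in \<open>s\<^sup>2\<close>, with poles at
    \<open>2*x - 1\<close> and \<open>- u\<^sup>2\<close>. Eliminating \<open>x\<close> through
    \<open>2*x - 1 = s\<^sup>2 + 2*d\<close> turns the claim into a rational identity.\<close>
  also have "2 / (2*x - 1 + u\<^sup>2) * ((2*x - 1) / (2 * (x - y) * s) - u\<^sup>2 / (s\<^sup>2 + u\<^sup>2) / s)
      = kernel u y / (x - y)"
  proof -
    define d where "d = x - y"
    have d: "d \<noteq> 0" "2*x - 1 = s\<^sup>2 + 2*d" using y s by (auto simp: d_def)
    have nz: "s\<^sup>2 + 2*d + u\<^sup>2 \<noteq> 0" using pos d by simp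
    have "(s\<^sup>2 + 2*d) / (2 * d * s) - u\<^sup>2 / (s\<^sup>2 + u\<^sup>2) / s
        = s * (s\<^sup>2 + 2*d + u\<^sup>2) / (2 * d * (s\<^sup>2 + u\<^sup>2))"
      using d(1) s(1) pos(1) by (simp add: divide_simps) algebra
    then show ?thesis
      unfolding kernel_def s_def[symmetric] d_def[symmetric] d(2) s(2) using nz s(1) by (simp add: mult.commute)
  qed
  finally show ?thesis .
qed

lemma isCont_mult_arctan_divide:
  fixes u :: real
  shows "isCont (\<lambda>y. u * arctan (sqrt (2*y - 1) / u)) y"
  by (cases "u = 0") (auto intro!: continuous_intros)

text \<open>The square root is 0 at \<open>1/2\<close>, so the antiderivative vanishes there and
  only its value at \<open>x - e\<close> remains.\<close>

lemma kernel_quotient_left: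
  assumes x: "1/2 < x" and e: "0 < e" "e < x - 1/2"
  defines "a \<equiv> sqrt (2*x - 1)" and "s \<equiv> sqrt (2*(x - e) - 1)"
  shows "has_bochner_integral lborel (\<lambda>y. indicator {1/2<..<x - e} y * (kernel u y / (x - y)))
    (2 / (2*x - 1 + u\<^sup>2) * (a / 2 * (ln (a + s) - ln (a - s)) - u * arctan (s / u)))"
proof -
  define D where "D = (\<lambda>y. ln (a + sqrt (2*y - 1)) - ln (a - sqrt (2*y - 1)))"
  define F where "F = (\<lambda>y. 2 / (2*x - 1 + u\<^sup>2) * (a / 2 * D y - u * arctan (sqrt (2*y - 1) / u)))"
  have a: "a > 0" "a\<^sup>2 = 2*x - 1" using x by (auto simp: a_def)
  have less: "0 \<le> sqrt (2*y - 1)" "sqrt (2*y - 1) < a" if "1/2 \<le> y" "y < x" for y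
    using that by (auto simp: a_def)
  have cont: "isCont F y" if y: "1/2 \<le> y" "y < x" for y
  proof -
    have "isCont (\<lambda>y. ln (a + sqrt (2*y - 1))) y" "isCont (\<lambda>y. ln (a - sqrt (2*y - 1))) y"
      using less[OF y] a(1) by (auto intro!: continuous_intros simp: add_pos_nonneg less_imp_neq[symmetric])
    then show ?thesis
      unfolding F_def D_def by (intro isCont_diff isCont_mult continuous_const isCont_mult_arctan_divide)
  qed
  have D: "(D has_real_derivative a / (x - y) / sqrt (2*y - 1)) (at y)" if y: "1/2 < y" "y < x" for y
  proof -
    define t where "t = sqrt (2*y - 1)"
    have t: "0 < t" "t < a" "t\<^sup>2 = 2*y - 1" using y less[of y] by (auto simp: t_def)
    \<comment> \<open>This is the common denominator of the derivatives of the two logarithms in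
      \<open>D\<close>.\<close>
    have xy: "x - y = (a + t) * (a - t) / 2"
    proof -
      have "x = (a\<^sup>2 + 1) / 2" "y = (t\<^sup>2 + 1) / 2" using a t by simp_all
      then show ?thesis by (simp add: field_simps power2_eq_square)
    qed
    have dt: "((\<lambda>y. sqrt (2*y - 1)) has_real_derivative 1 / t) (at y)"
      unfolding t_def by (rule has_derivative_sqrt_affine) (rule y)
    have "(D has_real_derivative (0 + 1 / t) / (a + sqrt (2*y - 1)) - (0 - 1 / t) / (a - sqrt (2*y - 1))) (at y)"
      unfolding D_def
      by (intro DERIV_diff has_real_derivative_ln_compose DERIV_add DERIV_const dt)
         (use t a in \<open>auto simp: t_def[symmetric]\<close>)
    also have "(0 + 1 / t) / (a + sqrt (2*y - 1)) - (0 - 1 / t) / (a - sqrt (2*y - 1)) = (1 / t) / (a + t) + (1 / t) / (a - t)"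
      by (simp add: t_def)
    also have "\<dots> = a / (x - y) / t"
      unfolding xy using t a by (simp add: divide_simps)
    finally show ?thesis by (simp add: t_def)
  qed
  have "has_bochner_integral lborel (\<lambda>y. indicator {1/2<..<x - e} y * (kernel u y / (x - y)))
      (F (x - e) - F (1/2))"
  proof (rule has_bochner_integral_FTC_Ioo_nonneg)
    show "(F has_real_derivative kernel u y / (x - y)) (at y)" if "1/2 < y" "y < x - e" for y
      unfolding F_def a_def
      by (rule kernel_quotient_antiderivative) (use x that e D[of y] in \<open>auto simp: a_def\<close>)
    show "isCont (\<lambda>y. kernel u y / (x - y)) y" if "1/2 < y" "y < x - e" for y
      by (intro continuous_intros isCont_kernel) (use that e in auto)
    show "0 \<le> kernel u y / (x - y)" if "1/2 < y" "y < x - e" for y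
      using that e by (simp add: kernel_nonneg)
    show "(F \<longlongrightarrow> F (1/2)) (at_right (1/2))" "(F \<longlongrightarrow> F (x - e)) (at_left (x - e))"
      using cont[of "1/2"] cont[of "x - e"] x e
      by (auto simp: isCont_def intro: tendsto_within_subset)
  qed (use e in simp)
  moreover have "F (1/2) = 0" by (simp add: F_def D_def)
  ultimately show ?thesis by (simp add: F_def D_def s_def)
qed

text \<open>At infinity the logarithms cancel, while \<open>u * arctan (sqrt (2*y - 1) / u)\<close>
  tends to \<open>u * pi / 2\<close>. That boundary term is what survives in the principal
  value.\<close>

lemma kernel_quotient_right:
  assumes x: "1/2 < x" and e: "0 < e" and u: "0 \<le> u"
  defines "a \<equiv> sqrt (2*x - 1)" and "s \<equiv> sqrt (2*(x + e) - 1)"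
  shows "has_bochner_integral lborel (\<lambda>y. indicator {x + e<..} y * (kernel u y / (x - y)))
    (- (2 / (2*x - 1 + u\<^sup>2) * (a / 2 * (ln (s + a) - ln (s - a)) + u * pi / 2 - u * arctan (s / u))))"
proof -
  define D where "D = (\<lambda>y. ln (sqrt (2*y - 1) + a) - ln (sqrt (2*y - 1) - a))"
  define F where "F = (\<lambda>y. 2 / (2*x - 1 + u\<^sup>2) * (a / 2 * D y - u * arctan (sqrt (2*y - 1) / u)))"
  have a: "a > 0" "a\<^sup>2 = 2*x - 1" using x by (auto simp: a_def)
  have less: "a < sqrt (2*y - 1)" if "x < y" for y
    using that by (auto simp: a_def)
  have cont: "isCont F y" if y: "x < y" for y
  proof -
    have "isCont (\<lambda>y. ln (sqrt (2*y - 1) + a)) y" "isCont (\<lambda>y. ln (sqrt (2*y - 1) - a)) y"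
      using less[OF y] a(1) by (auto intro!: continuous_intros simp: add_pos_nonneg less_imp_neq[symmetric])
    then show ?thesis
      unfolding F_def D_def by (intro isCont_diff isCont_mult continuous_const isCont_mult_arctan_divide)
  qed
  have D: "(D has_real_derivative a / (x - y) / sqrt (2*y - 1)) (at y)" if y: "x < y" for y
  proof -
    define t where "t = sqrt (2*y - 1)"
    have t: "a < t" "t\<^sup>2 = 2*y - 1" using x y less[of y] by (auto simp: t_def)
    have xy: "x - y = - ((t + a) * (t - a) / 2)"
    proof -
      have "x = (a\<^sup>2 + 1) / 2" "y = (t\<^sup>2 + 1) / 2" using a t by simp_all
      then show ?thesis by (simp add: field_simps power2_eq_square)
    qed
    have y': "1/2 < y" using x y by simp
    have dt: "((\<lambda>y. sqrt (2*y - 1)) has_real_derivative 1 / t) (at y)"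
      unfolding t_def by (rule has_derivative_sqrt_affine) (rule y')
    have "(D has_real_derivative (1 / t + 0) / (sqrt (2*y - 1) + a) - (1 / t - 0) / (sqrt (2*y - 1) - a)) (at y)"
      unfolding D_def
      by (intro DERIV_diff has_real_derivative_ln_compose DERIV_add DERIV_const dt)
         (use t a in \<open>auto simp: t_def\<close>)
    also have "(1 / t + 0) / (sqrt (2*y - 1) + a) - (1 / t - 0) / (sqrt (2*y - 1) - a) = (1 / t) / (t + a) - (1 / t) / (t - a)"
      by (simp add: t_def)
    also have "\<dots> = a / (x - y) / t"
      unfolding xy using t a by (simp add: divide_simps)
    finally show ?thesis by (simp add: t_def)
  qed
  have lim_arctan: "((\<lambda>y. u * arctan (sqrt (2*y - 1) / u)) \<longlongrightarrow> u * (pi / 2)) at_top"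
  proof (cases "u = 0")
    case False
    then have "filterlim (\<lambda>y. sqrt (2*y - 1) / u) at_top at_top"
      using u filterlim_tendsto_pos_mult_at_top[OF tendsto_const[of "1/u"] _ filterlim_sqrt_affine_at_top]
      by simp
    then show ?thesis
      by (intro tendsto_mult tendsto_const filterlim_compose[OF tendsto_arctan_at_top])
  qed simp
  have "((\<lambda>t. ln (t + a) - ln (t - a)) \<longlongrightarrow> 0) at_top"
    using a(1) by (rule tendsto_ln_add_diff_ln_diff_at_top)
  then have lim_D: "(D \<longlongrightarrow> 0) at_top"
    unfolding D_def by (rule filterlim_compose) (rule filterlim_sqrt_affine_at_top)
  have lim: "(F \<longlongrightarrow> 2 / (2*x - 1 + u\<^sup>2) * (a / 2 * 0 - u * (pi / 2))) at_top"
    unfolding F_def by (intro tendsto_mult tendsto_diff tendsto_const lim_D lim_arctan)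
  \<comment> \<open>Right of \<open>x\<close> the quotient is nonpositive, so the rule for
    nonnegative integrands is applied to its negative.\<close>
  have "has_bochner_integral lborel (\<lambda>y. indicator {x + e<..} y * (- (kernel u y / (x - y))))
      (- (2 / (2*x - 1 + u\<^sup>2) * (a / 2 * 0 - u * (pi / 2))) - - F (x + e))"
  proof (rule has_bochner_integral_FTC_Ioi_nonneg)
    show "((\<lambda>y. - F y) has_real_derivative - (kernel u y / (x - y))) (at y)" if "x + e < y" for y
      unfolding F_def a_def
      by (rule DERIV_minus, rule kernel_quotient_antiderivative)
         (use x that e D[of y] in \<open>auto simp: a_def\<close>)
    show "isCont (\<lambda>y. - (kernel u y / (x - y))) y" if "x + e < y" for y
      by (intro continuous_intros isCont_kernel) (use that e x in auto)
    show "0 \<le> - (kernel u y / (x - y))" if "x + e < y" for y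
      using that e x by (simp add: kernel_nonneg divide_nonneg_neg divide_le_0_iff)
    show "((\<lambda>y. - F y) \<longlongrightarrow> - F (x + e)) (at_right (x + e))"
      using cont[of "x + e"] e
      by (intro tendsto_minus) (auto simp: isCont_def intro: tendsto_within_subset)
    show "((\<lambda>y. - F y) \<longlongrightarrow> - (2 / (2*x - 1 + u\<^sup>2) * (a / 2 * 0 - u * (pi / 2)))) at_top"
      by (intro tendsto_minus lim)
  qed
  from has_bochner_integral_minus[OF this] show ?thesis
    by (simp add: F_def D_def s_def algebra_simps)
qed

section \<open>Exchange of the integrals over \<open>u\<close> and \<open>y\<close>\<close>

text \<open>Fubini's theorem for \<open>arctan\<close> written as an integral of
  \<open>kernel\<close>. The weight has to vanish up to \<open>1/2\<close> because that
  representation and the majorant are available only for \<open>y > 1/2\<close>. Later the weight is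
  \<open>excision x e\<close>.\<close>

lemma integral_arctan_mult:
  fixes w :: "real \<Rightarrow> real"
  assumes w [measurable]: "w \<in> borel_measurable borel"
    and supp: "\<And>y. y \<le> 1/2 \<Longrightarrow> w y = 0"
    and int: "integrable lborel (\<lambda>y. kernel 0 y * w y)"
  shows "integrable lborel (\<lambda>y. arctan (1 / sqrt (2*y - 1)) * w y)"
    and "integrable lborel (\<lambda>u. indicator {0..1} u * (LBINT y. kernel u y * w y))"
    and "(LBINT y. arctan (1 / sqrt (2*y - 1)) * w y)
         = (LBINT u. indicator {0..1} u * (LBINT y. kernel u y * w y))"
proof -
  define f where "f = (\<lambda>u y. indicator {0..1::real} u * (kernel u y * w y))"
  have f_meas [measurable]: "case_prod f \<in> borel_measurable (lborel \<Otimes>\<^sub>M lborel)"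
    unfolding f_def by measurable
  \<comment> \<open>Domination by the case \<open>u = 0\<close> gives integrability on the product.\<close>
  have bound: "\<bar>f u y\<bar> \<le> indicator {0..1} u * \<bar>kernel 0 y * w y\<bar>" for u y
  proof (cases "y \<le> 1/2")
    case False
    then show ?thesis
      using kernel_nonneg[of y u] kernel_le_kernel_0[of y u]
      by (auto simp: f_def abs_mult indicator_def intro!: mult_right_mono)
  qed (simp add: f_def supp)
  have "integrable (lborel \<Otimes>\<^sub>M lborel) (\<lambda>(u, y). indicator {0..1::real} u * \<bar>kernel 0 y * w y\<bar>)"
    by (rule lborel_pair.Fubini_integrable) (use int in auto)
  then have f_int: "integrable (lborel \<Otimes>\<^sub>M lborel) (case_prod f)"
    by (rule Bochner_Integration.integrable_bound) (use bound in auto)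
  have fy: "(LBINT u. f u y) = arctan (1 / sqrt (2*y - 1)) * w y" for y
  proof (cases "y \<le> 1/2")
    case False
    have "has_bochner_integral lborel (\<lambda>u. indicator {0..1} u * kernel u y * w y)
        (arctan (1 / sqrt (2*y - 1)) * w y)"
      by (rule has_bochner_integral_mult_left) (use False arctan_eq_integral_kernel in auto)
    then show ?thesis by (simp add: has_bochner_integral_iff f_def mult.assoc)
  qed (simp add: f_def supp)
  have fu: "(LBINT y. f u y) = indicator {0..1} u * (LBINT y. kernel u y * w y)" for u
    by (simp add: f_def)
  show "integrable lborel (\<lambda>y. arctan (1 / sqrt (2*y - 1)) * w y)"
    using lborel_pair.integrable_snd[OF f_int] by (simp add: fy)
  show "integrable lborel (\<lambda>u. indicator {0..1} u * (LBINT y. kernel u y * w y))"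
    using lborel_pair.integrable_fst[OF f_int] by (simp add: fu)
  show "(LBINT y. arctan (1 / sqrt (2*y - 1)) * w y)
         = (LBINT u. indicator {0..1} u * (LBINT y. kernel u y * w y))"
    using lborel_pair.Fubini_integral[OF f_int] by (simp add: fu fy)
qed

section \<open>Arctangent bounds; continuity and range of \<open>rho\<close>\<close>

text \<open>The derivative of \<open>t - arctan t\<close> is \<open>1 - 1 / (1 + t\<^sup>2)\<close>,
  which is nonnegative.\<close>

lemma arctan_diff_le: "a \<le> b \<Longrightarrow> arctan b - arctan a \<le> b - a"
  using DERIV_nonneg_imp_nondecreasing[of a b "\<lambda>t. t - arctan t"]
  by (force intro!: derivative_eq_intros simp: divide_simps add_pos_nonneg intro: exI)

text \<open>This is \<open>sin (2 * \<theta>) \<le> 2 * \<theta>\<close> for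
  \<open>\<theta> = arctan v\<close>, since then
  \<open>sin (2 * \<theta>) = 2 * v / (1 + v\<^sup>2)\<close>. With
  \<open>v = 1 / sqrt (2*y - 1)\<close> it says that \<open>rho y\<close> is nonnegative.\<close>

lemma divide_le_arctan:
  fixes v :: real
  assumes "0 \<le> v"
  shows "v / (1 + v\<^sup>2) \<le> arctan v"
proof -
  have "sin (2 * arctan v) \<le> 2 * arctan v" using assms by (intro sin_x_le_x) simp
  then show ?thesis
    by (simp add: sin_double sin_arctan cos_arctan real_sqrt_mult[symmetric] add_nonneg_nonneg)
qed

text \<open>For \<open>s = sqrt (2*y - 1) > 0\<close> use
  \<open>arctan (1 / s) = pi / 2 - arctan s\<close> and \<open>2*y = 1 + s\<^sup>2\<close>; for
  \<open>y \<le> 1/2\<close> the maximum is 0. A formula without cases makes continuity and the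
  upper bound immediate.\<close>

lemma rho_eq: "rho y = 1 - 2 / pi * (arctan (sqrt (max 0 (2*y - 1)))
    + sqrt (max 0 (2*y - 1)) / (1 + max 0 (2*y - 1)))"
proof (cases "y \<le> 1/2")
  case False
  define s where "s = sqrt (2*y - 1)"
  have "s > 0" "2*y = 1 + s\<^sup>2" "max 0 (2*y - 1) = s\<^sup>2" using False by (auto simp: s_def)
  then show ?thesis
    using False arctan_inverse[of s]
    by (simp add: rho_def inverse_eq_divide field_simps)
qed (simp add: rho_def max_absorb1)

lemma continuous_on_rho: "continuous_on A rho"
  unfolding rho_eq[abs_def] by (intro continuous_intros) (auto simp: add_pos_nonneg less_imp_neq[symmetric])

lemma rho_le_1: "rho y \<le> 1"
  unfolding rho_eq by (auto intro!: add_nonneg_nonneg divide_nonneg_nonneg)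

lemma rho_nonneg: "0 \<le> rho y"
proof (cases "y \<le> 1/2")
  case False
  define v where "v = 1 / sqrt (2*y - 1)"
  have v: "v > 0" using False by (simp add: v_def)
  then have "v / (1 + v\<^sup>2) \<le> arctan v" by (intro divide_le_arctan) simp
  moreover have "v / (1 + v\<^sup>2) = sqrt (2*y - 1) / (2*y)"
    using False by (simp add: v_def field_simps power2_eq_square)
  ultimately show ?thesis using False by (simp add: rho_def v_def)
qed (simp add: rho_def)

section \<open>The total mass of \<open>rho\<close>\<close>

text \<open>The interval up to \<open>1/2\<close> and the tail contribute \<open>1/2\<close> each.
  On the tail, \<open>s = sqrt (2*y - 1)\<close> gives \<open>dy = s ds\<close>, and
  \<open>Q\<close> is an antiderivative in \<open>s\<close>.\<close>

lemma integral_rho: "has_bochner_integral lborel (\<lambda>y. indicator {0..} y * rho y) 1"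
proof -
  \<comment> \<open>Integration by parts: the second summand is the antiderivative of
    \<open>2 * s\<^sup>2 / (1 + s\<^sup>2)\<^sup>2 / pi\<close>, which remains after differentiating
    the bracket in the first.\<close>
  define Q where "Q = (\<lambda>s. s\<^sup>2 / 2 * (1 - 2 / pi * (arctan s + s / (1 + s\<^sup>2)))
    + (arctan s - s / (1 + s\<^sup>2)) / pi)"
  have pos: "1 + s\<^sup>2 > 0" for s :: real by (simp add: add_pos_nonneg)
  have dQ: "(Q has_real_derivative s * (1 - 2 / pi * (arctan s + s / (1 + s\<^sup>2)))) (at s)" for s
  proof -
    define g where "g = (\<lambda>s::real. s / (1 + s\<^sup>2))"
    have dg: "(g has_real_derivative (1 - s\<^sup>2) / (1 + s\<^sup>2)\<^sup>2) (at s)"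
      unfolding g_def using pos[of s]
      by (auto intro!: derivative_eq_intros simp: power2_eq_square algebra_simps)
    have dA: "(arctan has_real_derivative 1 / (1 + s\<^sup>2)) (at s)"
      using DERIV_arctan[of s] by (simp add: inverse_eq_divide)
    define h where "h = (\<lambda>s. arctan s + g s)"
    define k where "k = (\<lambda>s. arctan s - g s)"
    have eq: "1 / (1 + s\<^sup>2) + (1 - s\<^sup>2) / (1 + s\<^sup>2)\<^sup>2 = 2 / (1 + s\<^sup>2)\<^sup>2"
      "1 / (1 + s\<^sup>2) - (1 - s\<^sup>2) / (1 + s\<^sup>2)\<^sup>2 = 2 * s\<^sup>2 / (1 + s\<^sup>2)\<^sup>2"
    proof -
      have "1 / (1 + s\<^sup>2) = (1 + s\<^sup>2) / (1 + s\<^sup>2)\<^sup>2"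
        using pos[of s] by (simp add: power2_eq_square)
      then show "1 / (1 + s\<^sup>2) + (1 - s\<^sup>2) / (1 + s\<^sup>2)\<^sup>2 = 2 / (1 + s\<^sup>2)\<^sup>2"
        "1 / (1 + s\<^sup>2) - (1 - s\<^sup>2) / (1 + s\<^sup>2)\<^sup>2 = 2 * s\<^sup>2 / (1 + s\<^sup>2)\<^sup>2"
        by (simp_all only: add_divide_distrib[symmetric] diff_divide_distrib[symmetric]) simp_all
    qed
    have dh: "(h has_real_derivative 2 / (1 + s\<^sup>2)\<^sup>2) (at s)"
      using DERIV_add[OF dA dg] by (simp add: h_def eq)
    have dk: "(k has_real_derivative 2 * s\<^sup>2 / (1 + s\<^sup>2)\<^sup>2) (at s)"
      using DERIV_diff[OF dA dg] by (simp only: k_def eq)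
    have "((\<lambda>s. s\<^sup>2 / 2 * (1 - 2 / pi * h s) + k s / pi) has_real_derivative
        s * (1 - 2 / pi * h s) + s\<^sup>2 / 2 * (- (2 / pi * (2 / (1 + s\<^sup>2)\<^sup>2)))
          + 2 * s\<^sup>2 / (1 + s\<^sup>2)\<^sup>2 / pi) (at s)"
      by (rule derivative_eq_intros dh dk refl | simp)+
    then show ?thesis by (simp add: Q_def h_def k_def g_def)
  qed
  have Q_lim: "(Q \<longlongrightarrow> 1/2) at_top"
  proof -
    have inv: "((\<lambda>s::real. 1 / s) \<longlongrightarrow> 0) at_top"
      by (intro tendsto_divide_0[OF tendsto_const] filterlim_at_top_imp_at_infinity filterlim_ident)
    have g: "((\<lambda>s::real. s / (1 + s\<^sup>2)) \<longlongrightarrow> 0) at_top"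
    proof (rule tendsto_sandwich[OF _ _ tendsto_const inv])
      show "eventually (\<lambda>s::real. 0 \<le> s / (1 + s\<^sup>2)) at_top"
        using eventually_gt_at_top[of 0] by eventually_elim simp
      show "eventually (\<lambda>s::real. s / (1 + s\<^sup>2) \<le> 1 / s) at_top"
        using eventually_gt_at_top[of 0]
        by eventually_elim (use pos in \<open>simp add: divide_simps power2_eq_square\<close>)
    qed
    \<comment> \<open>A product of the form infinity times 0. In terms of \<open>v = 1 / s\<close>
      the bracket is \<open>2 / pi * (arctan v - v / (1 + v\<^sup>2))\<close>, which is nonnegative
      and of third order in \<open>v\<close>, so the product is squeezed between 0 and
      \<open>1 / s\<close>.\<close>
    have first: "((\<lambda>s. s\<^sup>2 / 2 * (1 - 2 / pi * (arctan s + s / (1 + s\<^sup>2)))) \<longlongrightarrow> 0) at_top"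
    proof (rule tendsto_sandwich[OF _ _ tendsto_const inv])
      have eq: "s\<^sup>2 / 2 * (1 - 2 / pi * (arctan s + s / (1 + s\<^sup>2)))
          = s\<^sup>2 / pi * (arctan (1 / s) - (1 / s) / (1 + (1 / s)\<^sup>2))" if "s > 0" for s
      proof -
        have G: "(1 / s) / (1 + (1 / s)\<^sup>2) = s / (1 + s\<^sup>2)"
          using that pos[of s] by (simp add: divide_simps power2_eq_square)
        have A: "arctan s = pi / 2 - arctan (1 / s)"
          using arctan_inverse[of s] that by (simp add: inverse_eq_divide sgn_if)
        have B: "1 - 2 / pi * (pi / 2 - B + G) = 2 / pi * (B - G)" for B G :: real
          by (simp add: field_simps)
        have C: "c / 2 * (2 / pi * P) = c / pi * P" for c P :: real
          by simp
        show ?thesis unfolding G unfolding A unfolding B by (rule C)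
      qed
      show "eventually (\<lambda>s. 0 \<le> s\<^sup>2 / 2 * (1 - 2 / pi * (arctan s + s / (1 + s\<^sup>2)))) at_top"
        using eventually_gt_at_top[of 0]
      proof eventually_elim
        case (elim s)
        then show ?case
          using divide_le_arctan[of "1 / s"] unfolding eq[OF elim] by (intro mult_nonneg_nonneg) auto
      qed
      show "eventually (\<lambda>s. s\<^sup>2 / 2 * (1 - 2 / pi * (arctan s + s / (1 + s\<^sup>2))) \<le> 1 / s) at_top"
        using eventually_gt_at_top[of 0]
      proof eventually_elim
        case (elim s)
        have "arctan (1 / s) - (1 / s) / (1 + (1 / s)\<^sup>2) \<le> 1 / s - (1 / s) / (1 + (1 / s)\<^sup>2)"
          using elim arctan_diff_le[of 0 "1 / s"] by simp
        also have "\<dots> = 1 / (s * (1 + s\<^sup>2))"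
          using elim pos[of s] by (simp add: divide_simps power2_eq_square)
        finally have "s\<^sup>2 / pi * (arctan (1 / s) - (1 / s) / (1 + (1 / s)\<^sup>2))
            \<le> s\<^sup>2 / pi * (1 / (s * (1 + s\<^sup>2)))"
          by (intro mult_left_mono) auto
        also have "\<dots> = (1 / pi) * (s\<^sup>2 / (1 + s\<^sup>2)) * (1 / s)"
          by simp
        also have "\<dots> \<le> 1 * 1 * (1 / s)"
          using elim pos[of s] pi_gt3 by (intro mult_mono) (auto simp: divide_simps)
        finally show ?case using eq[OF elim] by simp
      qed
    qed
    have "(Q \<longlongrightarrow> 0 + (pi / 2 - 0) / pi) at_top"
      unfolding Q_def
      by (rule tendsto_add[OF first tendsto_divide[OF tendsto_diff[OF tendsto_arctan_at_top g] tendsto_const]]) simp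
    then show ?thesis by simp
  qed
  have tail: "has_bochner_integral lborel (\<lambda>y. indicator {1/2<..} y * rho y) (1/2 - 0)"
  proof (rule has_bochner_integral_FTC_Ioi_nonneg)
    show "((\<lambda>y. Q (sqrt (2*y - 1))) has_real_derivative rho y) (at y)" if "1/2 < y" for y
      using DERIV_chain2[OF dQ has_derivative_sqrt_affine[OF that]] that
      by (simp add: rho_eq max_def)
    show "isCont rho y" if "1/2 < y" for y
      using continuous_on_rho[of UNIV] by (simp add: continuous_on_eq_continuous_at)
    show "0 \<le> rho y" for y by (rule rho_nonneg)
    have "isCont (\<lambda>y. Q (sqrt (2*y - 1))) (1/2)"
      by (rule isCont_o2[OF _ DERIV_isCont[OF dQ]]) (intro continuous_intros)
    moreover have "Q (sqrt (2*(1/2) - 1)) = 0" by (simp add: Q_def)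
    ultimately show "((\<lambda>y. Q (sqrt (2*y - 1))) \<longlongrightarrow> 0) (at_right (1/2))"
      unfolding isCont_def by (auto intro: tendsto_within_subset)
    show "((\<lambda>y. Q (sqrt (2*y - 1))) \<longlongrightarrow> 1/2) at_top"
      by (rule filterlim_compose[OF Q_lim filterlim_sqrt_affine_at_top])
  qed
  have "has_bochner_integral lborel (\<lambda>y. indicator {0..1/2::real} y :: real) (1/2)"
    using has_bochner_integral_FTC_Icc_real[of 0 "1/2" "\<lambda>y. y" "\<lambda>_. 1"] by simp
  from has_bochner_integral_add[OF this tail]
  have "has_bochner_integral lborel (\<lambda>y. indicator {0..1/2} y + indicator {1/2<..} y * rho y) 1"
    by simp
  also have "(\<lambda>y. indicator {0..1/2} y + indicator {1/2<..} y * rho y) = (\<lambda>y. indicator {0..} y * rho y)"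
    by (auto simp: fun_eq_iff indicator_def rho_def)
  finally show ?thesis .
qed

section \<open>Excised integrals and their error bounds\<close>

lemma integral_hyperbola:
  fixes x :: real
  assumes x: "1/2 < x"
  shows "has_bochner_integral lborel (\<lambda>y. indicator {0..1/2} y * (1 / (x - y))) (ln x - ln (x - 1/2))"
proof -
  have "has_bochner_integral lborel (\<lambda>y. (1 / (x - y)) * indicator {0..1/2} y)
           (- ln (x - 1/2) - - ln (x - 0))"
  proof (rule has_bochner_integral_FTC_Icc_real)
    fix y :: real assume "y \<le> 1/2"
    then have "x - y > 0" using x by simp
    then show "((\<lambda>y. - ln (x - y)) has_real_derivative 1 / (x - y)) (at y)"
      by (auto intro!: derivative_eq_intros simp: field_simps)
    show "isCont (\<lambda>y. 1 / (x - y)) y"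
      using \<open>x - y > 0\<close> by (intro continuous_intros) auto
  qed simp
  then show ?thesis by (simp add: mult.commute)
qed

text \<open>As \<open>arctan\<close> is 1-Lipschitz, the factor \<open>u\<close> cancels the
  \<open>u\<close> in the arguments. The bound is therefore uniform in \<open>u\<close>, as the
  later integration over \<open>u\<close> requires.\<close>

lemma abs_mult_arctan_diff_le:
  fixes u :: real
  assumes "0 \<le> u" "a \<le> b"
  shows "\<bar>u * arctan (b / u) - u * arctan (a / u)\<bar> \<le> b - a"
proof (cases "u = 0")
  case False
  with assms have "a / u \<le> b / u" "u > 0" by (auto intro: divide_right_mono)
  then have "u * (arctan (b / u) - arctan (a / u)) \<le> u * (b / u - a / u)"
    by (intro mult_left_mono arctan_diff_le) auto
  then show ?thesis
    using \<open>a / u \<le> b / u\<close> \<open>u > 0\<close> by (simp add: algebra_simps arctan_le_iff)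
qed (use assms in simp)

text \<open>Cutting at \<open>1/2\<close> also removes the junk values of \<^const>\<open>kernel\<close> left of \<open>1/2\<close>, where
  \<^const>\<open>sqrt\<close> of a negative number is negative.\<close>

definition excision :: "real \<Rightarrow> real \<Rightarrow> real \<Rightarrow> real" where
  "excision x e y = indicator ({1/2<..} - {x - e<..<x + e}) y / (x - y)"

lemma excision_measurable [measurable]: "excision x e \<in> borel_measurable borel"
  unfolding excision_def[abs_def] by measurable

text \<open>A bound, uniform in \<open>u\<close>, on the distance of the excised kernel integral
  from its limit. The first factor is \<open>2 / (2*x - 1 + u\<^sup>2)\<close> at its largest,
  \<open>u = 0\<close>; the modulus is what the logarithms leave over; the last difference bounds
  the arctangent terms.\<close>

definition pv_error :: "real \<Rightarrow> real \<Rightarrow> real" where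
  "pv_error x e = 2 / (2*x - 1) *
     (sqrt (2*x - 1) * \<bar>ln (sqrt (2*x - 1) + sqrt (2*(x - e) - 1)) - ln (sqrt (2*(x + e) - 1) + sqrt (2*x - 1))\<bar>
       + (sqrt (2*(x + e) - 1) - sqrt (2*(x - e) - 1)))"

lemma pv_error_tendsto:
  assumes "1/2 < x"
  shows "(pv_error x \<longlongrightarrow> 0) (at_right 0)"
proof -
  have nz: "sqrt (2*x - 1) + sqrt (2*x - 1) \<noteq> 0" using assms by simp
  have "isCont (\<lambda>e. ln (sqrt (2*x - 1) + sqrt (2*(x - e) - 1))) 0"
    "isCont (\<lambda>e. ln (sqrt (2*(x + e) - 1) + sqrt (2*x - 1))) 0"
    "isCont (\<lambda>e. sqrt (2*(x - e) - 1)) 0" "isCont (\<lambda>e. sqrt (2*(x + e) - 1)) 0"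
    using nz by (auto intro!: continuous_intros)
  then have "isCont (pv_error x) 0"
    unfolding pv_error_def[abs_def]
    by (intro isCont_mult isCont_add isCont_diff isCont_rabs continuous_const)
  moreover have "pv_error x 0 = 0" by (simp add: pv_error_def)
  ultimately show ?thesis
    unfolding isCont_def by (auto intro: tendsto_within_subset)
qed

text \<open>In the sum of the left and right integrals the logarithms combine to
  \<open>a * L\<close> and the arctangents to \<open>R\<close>, both small with \<open>e\<close>.
  The boundary term at infinity gives \<open>- pi * (u / (2*x - 1 + u\<^sup>2))\<close>.\<close>

lemma kernel_excised:
  assumes x: "1/2 < x" and e: "0 < e" "e < x - 1/2" and u: "0 \<le> u"
  shows "integrable lborel (\<lambda>y. kernel u y * excision x e y)"
    and "\<bar>(LBINT y. kernel u y * excision x e y) + pi * (u / (2*x - 1 + u\<^sup>2))\<bar> \<le> pv_error x e"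
proof -
  define a where "a = sqrt (2*x - 1)"
  define s1 where "s1 = sqrt (2*(x - e) - 1)"
  define s2 where "s2 = sqrt (2*(x + e) - 1)"
  define q where "q = 2 / (2*x - 1 + u\<^sup>2)"
  define L where "L = ln (a + s1) - ln (s2 + a)"
  define R where "R = u * arctan (s2 / u) - u * arctan (s1 / u)"
  have sq: "a\<^sup>2 = 2*x - 1" "s1\<^sup>2 = 2*(x - e) - 1" "s2\<^sup>2 = 2*(x + e) - 1"
    using x e by (simp_all add: a_def s1_def s2_def)
  have ord: "0 < a" "0 \<le> s1" "s1 < a" "a < s2"
    using x e by (simp_all add: a_def s1_def s2_def)
  \<comment> \<open>The symmetry of the excision enters here: since both products agree, the
    logarithms of \<open>a - s1\<close> and \<open>s2 - a\<close>, which diverge as \<open>e\<close>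
    tends to 0, differ by the harmless \<open>L\<close>. Hence \<open>a * L\<close> below instead of
    \<open>a / 2 * L\<close>.\<close>
  have "(a + s1) * (a - s1) = 2*e" "(s2 + a) * (s2 - a) = 2*e"
    using sq by (simp_all add: algebra_simps power2_eq_square)
  then have "ln (a + s1) + ln (a - s1) = ln (s2 + a) + ln (s2 - a)"
    using ord by (subst (1 2) ln_mult_pos[symmetric]) auto
  then have ln_eq: "ln (a - s1) = ln (s2 + a) + ln (s2 - a) - ln (a + s1)"
    by simp
  have "has_bochner_integral lborel
      (\<lambda>y. indicator {1/2<..<x - e} y * (kernel u y / (x - y)) + indicator {x + e<..} y * (kernel u y / (x - y)))
      (q * (a / 2 * (ln (a + s1) - ln (a - s1)) - u * arctan (s1 / u))
        + - (q * (a / 2 * (ln (s2 + a) - ln (s2 - a)) + u * pi / 2 - u * arctan (s2 / u))))"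
    unfolding a_def s1_def s2_def q_def
    by (intro has_bochner_integral_add kernel_quotient_left kernel_quotient_right x e u)
  also have "q * (a / 2 * (ln (a + s1) - ln (a - s1)) - u * arctan (s1 / u))
        + - (q * (a / 2 * (ln (s2 + a) - ln (s2 - a)) + u * pi / 2 - u * arctan (s2 / u)))
      = q * (a * L + R) - pi * (u / (2*x - 1 + u\<^sup>2))"
  proof -
    have "pi * (u / D) = 2 / D * (u * pi / 2)" for D :: real by (simp add: mult_ac)
    then have pi_eq: "pi * (u / (2*x - 1 + u\<^sup>2)) = q * (u * pi / 2)" unfolding q_def .
    show ?thesis unfolding pi_eq ln_eq L_def R_def by (simp add: field_simps)
  qed
  finally have *: "has_bochner_integral lborel (\<lambda>y. kernel u y * excision x e y)
      (q * (a * L + R) - pi * (u / (2*x - 1 + u\<^sup>2)))"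
  proof (rule has_bochner_integralI_AE)
    \<comment> \<open>\<open>excision\<close> keeps the end points \<open>x - e\<close> and
      \<open>x + e\<close>, which the two open intervals omit.\<close>
    show "AE y in lborel. indicator {1/2<..<x - e} y * (kernel u y / (x - y))
        + indicator {x + e<..} y * (kernel u y / (x - y)) = kernel u y * excision x e y"
      using AE_lborel_singleton[of "x - e"] AE_lborel_singleton[of "x + e"]
      by eventually_elim (use x e in \<open>auto simp: excision_def indicator_def\<close>)
  qed measurable
  then show "integrable lborel (\<lambda>y. kernel u y * excision x e y)"
    by (simp add: has_bochner_integral_iff)
  have q: "0 \<le> q" "q \<le> 2 / (2*x - 1)"
    using x by (auto simp: q_def add_pos_nonneg intro!: frac_le)
  have pv_error_eq: "pv_error x e = 2 / (2*x - 1) * (a * \<bar>L\<bar> + (s2 - s1))"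
    by (simp only: pv_error_def a_def s1_def s2_def L_def)
  have "\<bar>R\<bar> \<le> s2 - s1"
    unfolding R_def using u ord by (intro abs_mult_arctan_diff_le) auto
  then have "\<bar>a * L + R\<bar> \<le> a * \<bar>L\<bar> + (s2 - s1)"
    using ord abs_triangle_ineq[of "a * L" R] by (simp add: abs_mult)
  then have "q * \<bar>a * L + R\<bar> \<le> 2 / (2*x - 1) * (a * \<bar>L\<bar> + (s2 - s1))"
    using q x by (intro mult_mono) auto
  then show "\<bar>(LBINT y. kernel u y * excision x e y) + pi * (u / (2*x - 1 + u\<^sup>2))\<bar> \<le> pv_error x e"
    using * q unfolding pv_error_eq by (simp add: has_bochner_integral_iff abs_mult)
qed

text \<open>The uniform bound for \<open>kernel u\<close> is integrated over \<open>u\<close> in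
  \<open>{0..1}\<close>; as this interval has length 1, \<open>pv_error\<close> is
  preserved.\<close>

lemma integral_arctan_excised:
  assumes x: "1/2 < x" and e: "0 < e" "e < x - 1/2"
  shows "integrable lborel (\<lambda>y. arctan (1 / sqrt (2*y - 1)) * excision x e y)"
    and "\<bar>(LBINT y. arctan (1 / sqrt (2*y - 1)) * excision x e y) + pi / 2 * (ln x - ln (x - 1/2))\<bar>
           \<le> pv_error x e"
proof -
  define H where "H = (\<lambda>u. LBINT y. kernel u y * excision x e y)"
  have int0: "integrable lborel (\<lambda>y. kernel 0 y * excision x e y)"
    by (rule kernel_excised(1)) (use x e in auto)
  have supp: "excision x e y = 0" if "y \<le> 1/2" for y
    using that by (simp add: excision_def)
  note arc = integral_arctan_mult[OF excision_measurable supp int0]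
  show "integrable lborel (\<lambda>y. arctan (1 / sqrt (2*y - 1)) * excision x e y)" by (rule arc)
  have "2*x - 1 > 0" using x by simp
  note ratio = integral_ratio_eq_ln[OF this]
  \<comment> \<open>Both arguments contain a factor 2, whose logarithm cancels.\<close>
  have ln: "ln (2*x - 1 + 1) - ln (2*x - 1) = ln x - ln (x - 1/2)"
    using x ln_mult_pos[of 2 x] ln_mult_pos[of 2 "x - 1/2"] by (simp add: algebra_simps)
  have int: "integrable lborel (\<lambda>u. indicator {0..1} u * H u)"
    using arc(2) by (simp add: H_def)
  have int_ratio: "has_bochner_integral lborel (\<lambda>u. pi * (indicator {0..1} u * (u / (2*x - 1 + u\<^sup>2))))
      (pi * ((ln x - ln (x - 1/2)) / 2))"
    using ratio unfolding ln by (intro has_bochner_integral_mult_right)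
  note sum = has_bochner_integral_add[OF has_bochner_integral_integrable[OF int] int_ratio]
  have "(LBINT u. indicator {0..1} u * H u) + pi / 2 * (ln x - ln (x - 1/2))
      = (LBINT u. indicator {0..1} u * H u + pi * (indicator {0..1} u * (u / (2*x - 1 + u\<^sup>2))))"
    unfolding has_bochner_integral_integral_eq[OF sum] by simp
  also have "\<bar>\<dots>\<bar> \<le> (LBINT u. indicator {0..1::real} u * pv_error x e)"
    unfolding real_norm_def[symmetric]
  proof (rule Bochner_Integration.integral_norm_bound_integral)
    show "integrable lborel (\<lambda>u. indicator {0..1} u * H u + pi * (indicator {0..1} u * (u / (2*x - 1 + u\<^sup>2))))"
      using sum by (rule integrable.intros)
    show "norm (indicator {0..1} u * H u + pi * (indicator {0..1} u * (u / (2*x - 1 + u\<^sup>2))))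
        \<le> indicator {0..1} u * pv_error x e" for u
      using kernel_excised(2)[OF x e, of u] by (auto simp: H_def indicator_def)
  qed simp
  also have "\<dots> = pv_error x e" by simp
  finally show "\<bar>(LBINT y. arctan (1 / sqrt (2*y - 1)) * excision x e y) + pi / 2 * (ln x - ln (x - 1/2))\<bar>
           \<le> pv_error x e"
    using arc(3) by (simp add: H_def)
qed

section \<open>The principal value for \<open>rho\<close>\<close>

text \<open>Right of \<open>1/2\<close>, \<open>rho y\<close> is
  \<open>2 / pi * (arctan (1 / sqrt (2*y - 1)) - kernel 1 y)\<close>. Each of the two terms has
  error at most \<open>pv_error x e\<close>, whence the constant \<open>4 / pi\<close>.\<close>

lemma rho_excised:
  assumes x: "1/2 < x" and e: "0 < e" "e < x - 1/2"
  shows "set_integrable lborel ({0..} - {x - e<..<x + e}) (\<lambda>y. rho y / (x - y))"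
    and "\<bar>(LBINT y:({0..} - {x - e<..<x + e}). rho y / (x - y)) - 1 / x\<bar> \<le> 4 / pi * pv_error x e"
proof -
  define A where "A = (LBINT y. arctan (1 / sqrt (2*y - 1)) * excision x e y)"
  define K where "K = (LBINT y. kernel 1 y * excision x e y)"
  have "has_bochner_integral lborel (\<lambda>y. indicator {0..1/2} y * (1 / (x - y))
      + 2 / pi * (arctan (1 / sqrt (2*y - 1)) * excision x e y - kernel 1 y * excision x e y))
      (ln x - ln (x - 1/2) + 2 / pi * (A - K))"
    unfolding A_def K_def
    by (intro has_bochner_integral_add has_bochner_integral_mult_right has_bochner_integral_diff
        has_bochner_integral_integrable integral_hyperbola integral_arctan_excised kernel_excised x e) simp
  also have "(\<lambda>y. indicator {0..1/2} y * (1 / (x - y))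
      + 2 / pi * (arctan (1 / sqrt (2*y - 1)) * excision x e y - kernel 1 y * excision x e y))
      = (\<lambda>y. indicator ({0..} - {x - e<..<x + e}) y *\<^sub>R (rho y / (x - y)))"
  proof
    fix y :: real
    show "indicator {0..1/2} y * (1 / (x - y))
      + 2 / pi * (arctan (1 / sqrt (2*y - 1)) * excision x e y - kernel 1 y * excision x e y)
      = indicator ({0..} - {x - e<..<x + e}) y *\<^sub>R (rho y / (x - y))"
    proof (cases "y \<le> 1/2")
      case True
      then show ?thesis using e by (simp add: indicator_def excision_def rho_def)
    next
      case False
      then have "rho y = 2 / pi * (arctan (1 / sqrt (2*y - 1)) - kernel 1 y)"
        by (simp add: rho_def kernel_def)
      with False show ?thesis
        by (simp add: indicator_def excision_def diff_divide_distrib[symmetric])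
    qed
  qed
  finally have *: "has_bochner_integral lborel
      (\<lambda>y. indicator ({0..} - {x - e<..<x + e}) y *\<^sub>R (rho y / (x - y)))
      (ln x - ln (x - 1/2) + 2 / pi * (A - K))" .
  then show "set_integrable lborel ({0..} - {x - e<..<x + e}) (\<lambda>y. rho y / (x - y))"
    by (simp add: set_integrable_def has_bochner_integral_iff)
  define EA where "EA = A + pi / 2 * (ln x - ln (x - 1/2))"
  define EK where "EK = K + pi * (1 / (2*x))"
  have "\<bar>EA\<bar> \<le> pv_error x e" "\<bar>EK\<bar> \<le> pv_error x e"
    unfolding EA_def A_def EK_def K_def
    using integral_arctan_excised(2)[OF x e] kernel_excised(2)[OF x e, of 1] by simp_all
  then have "\<bar>2 / pi * (EA - EK)\<bar> \<le> 2 / pi * (2 * pv_error x e)"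
    unfolding abs_mult by (intro mult_mono) auto
  \<comment> \<open>The limit of \<open>A\<close> cancels the logarithms from
    \<open>{0..1/2}\<close>, and the limit \<open>- pi / (2*x)\<close> of \<open>K\<close> produces
    \<open>1 / x\<close>.\<close>
  moreover have "ln x - ln (x - 1/2) + 2 / pi * (A - K) - 1 / x = 2 / pi * (EA - EK)"
    using x by (simp add: EA_def EK_def field_simps)
  ultimately show "\<bar>(LBINT y:({0..} - {x - e<..<x + e}). rho y / (x - y)) - 1 / x\<bar> \<le> 4 / pi * pv_error x e"
    using * by (simp add: set_lebesgue_integral_def has_bochner_integral_iff)
qed

lemma rho_has_pv_integral:
  assumes x: "1/2 < x"
  shows "has_pv_integral (\<lambda>y. rho y / (x - y)) (1 / x) {0..} x"
  unfolding has_pv_integral_def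
proof (intro conjI allI impI)
  fix e :: real assume e: "0 < e"
  \<comment> \<open>Integrability is demanded for every radius but known only below
    \<open>x - 1/2\<close>. A larger radius leaves a smaller set, so a small radius
    \<open>d \<le> e\<close> suffices.\<close>
  define d where "d = min e ((x - 1/2) / 2)"
  have d: "0 < d" "d < x - 1/2" "d \<le> e" using x e by (auto simp: d_def min_less_iff_disj)
  show "set_integrable lborel ({0..} - {x - e<..<x + e}) (\<lambda>y. rho y / (x - y))"
    by (rule set_integrable_subset[OF rho_excised(1)[OF x d(1,2)]]) (use d in auto)
next
  have ev: "eventually (\<lambda>e. e < x - 1/2 \<and> 0 < e) (at_right 0)"
    using x by (intro eventually_conj eventually_at_right_less)
      (auto simp: eventually_at_right_field intro!: exI[of _ "x - 1/2"])
  have "((\<lambda>e. 4 / pi * pv_error x e) \<longlongrightarrow> 4 / pi * 0) (at_right 0)"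
    by (intro tendsto_mult tendsto_const pv_error_tendsto x)
  then have lim: "((\<lambda>e. 4 / pi * pv_error x e) \<longlongrightarrow> 0) (at_right 0)" by simp
  have "((\<lambda>e. (LBINT y:({0..} - {x - e<..<x + e}). rho y / (x - y)) - 1 / x) \<longlongrightarrow> 0) (at_right 0)"
  proof (rule tendsto_0_le[OF lim, where K = 1], rule eventually_mono[OF ev])
    fix e assume "e < x - 1/2 \<and> 0 < e"
    then show "norm ((LBINT y:({0..} - {x - e<..<x + e}). rho y / (x - y)) - 1 / x)
        \<le> norm (4 / pi * pv_error x e) * 1"
      unfolding real_norm_def mult_1_right
      by (intro order_trans[OF rho_excised(2)[OF x] abs_ge_self]) auto
  qed
  then show "((\<lambda>e. LBINT y:({0..} - {x - e<..<x + e}). rho y / (x - y)) \<longlongrightarrow> 1 / x) (at_right 0)"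
    by (simp add: LIM_zero_iff)
qed

theorem theorem8:
  shows "continuous_on {0..} rho
    \<and> (\<forall>x::real. x > 1/2 \<longrightarrow> has_pv_integral (\<lambda>y. rho y / (x - y)) (1 / x) {0..} x)
    \<and> (set_integrable lborel {0..} rho \<and> (LBINT x:{0..}. rho x) = 1)
    \<and> (\<forall>x\<ge>0. 0 \<le> rho x \<and> rho x \<le> 1)"
  using integral_rho
  by (simp add: continuous_on_rho rho_has_pv_integral rho_nonneg rho_le_1
      set_integrable_def set_lebesgue_integral_def has_bochner_integral_iff)

end
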